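(* The function $p$ is convex and lies between $l$ and any $\hat f\in\mathcal{S}_{\mathbb{E},L_f}(\mathcal{I}_{\mathcal{Z}})$, namely $$l(y)\le p(y)\le\hat f(y),\qquad y\in\mathbb{E}.$$
   Context: $\mathbb{E}$ is an $n$-dimensional real vector space, $\mathbb{E}^*$ its dual, $\langle s,x\rangle$ the value of $s\in\mathbb{E}^*$ at $x\in\mathbb{E}$. $B:\mathbb{E}\to\mathbb{E}^*$ is a symmetric positive definite linear operator, $\|x\|=\sqrt{\langle Bx,x\rangle}$ on $\mathbb{E}$ and $\|g\|_*=\sqrt{\langle g,B^{-1}g\rangle}$ on $\mathbb{E}^*$. $f:\mathbb{E}\to\mathbb{R}$ is convex and differentiable, with gradient Lipschitz continuous with constant $L_f>0$ (i.e. $\|\nabla f(x)-\nabla f(y)\|_*\le L_f\|x-y\|$). Points $z_1,\dots,z_m\in\mathbb{E}$ ($m\ge1$) are given, with $f_i=f(z_i)$, $g_i=\nabla f(z_i)$; $\mathcal{Z}=\{z_1,\dots,z_m\}$ and $\mathcal{I}_{\mathcal{Z}}=\{(z_i,f_i,g_i)\mid i=1,\dots,m\}$. $\mathcal{S}_{\mathbb{E},L_f}(\mathcal{I}_{\mathcal{Z}})$ is the class of functions $\hat f:\mathbb{E}\to\mathbb{R}$ that are convex and differentiable on $\mathbb{E}$, have $L_f$-Lipschitz continuous gradient, and satisfy $\hat f(z_i)=f_i$, $\nabla\hat f(z_i)=g_i$ for all $i=1,\dots,m$. Define $l(y)=\max_{i=1,\dots,m}\{f_i+\langle g_i,y-z_i\rangle\}$,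 $\phi(y,g)=\max_{i=1,\dots,m}\left\{f_i+\langle g_i,y-z_i\rangle+\frac{1}{2L_f}\|g-g_i\|_*^2\right\}$ and $p(y)=\min_{g\in\mathbb{E}^*}\phi(y,g)$ for $y\in\mathbb{E}$, $g\in\mathbb{E}^*$. *)

theory Defs
  imports "HOL-Analysis.Analysis"
begin

(* The inner product and norm of the class euclidean_space play no mathematical role here: they
   only supply the finite-dimensional vector space with its (unique) linear topology, which is what
   differentiability refers to.  Every linear functional is bounded, so the type below is the whole
   algebraic dual.  All metric notions are taken with respect to B. *)
type_synonym 'a dual = "'a \<Rightarrow>\<^sub>L real"

definition sym_posdef :: "('a::euclidean_space \<Rightarrow> 'a dual) \<Rightarrow> bool" where
  "sym_posdef B \<longleftrightarrow> linear B
     \<and> (\<forall>x y. blinfun_apply (B x) y = blinfun_apply (B y) x)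
     \<and> (\<forall>x. x \<noteq> 0 \<longrightarrow> blinfun_apply (B x) x > 0)"

definition pnorm :: "('a::euclidean_space \<Rightarrow> 'a dual) \<Rightarrow> 'a \<Rightarrow> real" where
  "pnorm B x = sqrt (blinfun_apply (B x) x)"

definition dnorm :: "('a::euclidean_space \<Rightarrow> 'a dual) \<Rightarrow> 'a dual \<Rightarrow> real" where
  "dnorm B g = sqrt (blinfun_apply g (inv B g))"

(* The gradient is an element of the dual space; it is meaningful where f is differentiable. *)
definition grad :: "('a::euclidean_space \<Rightarrow> real) \<Rightarrow> 'a \<Rightarrow> 'a dual" where
  "grad f x = Blinfun (frechet_derivative f (at x))"

definition smooth_convex :: "('a::euclidean_space \<Rightarrow> 'a dual) \<Rightarrow> real \<Rightarrow> ('a \<Rightarrow> real) \<Rightarrow> bool" where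
  "smooth_convex B L f \<longleftrightarrow> convex_on UNIV f \<and> (\<forall>x. f differentiable (at x))
     \<and> (\<forall>x y. dnorm B (grad f x - grad f y) \<le> L * pnorm B (x - y))"

(* In the definitions below the data (z_i, f_i, g_i), i = 1,...,m, are three functions on nat
   that are only read at indices in {1..m}. *)

definition interp_class ::
  "('a::euclidean_space \<Rightarrow> 'a dual) \<Rightarrow> real \<Rightarrow> nat \<Rightarrow> (nat \<Rightarrow> 'a) \<Rightarrow> (nat \<Rightarrow> real) \<Rightarrow> (nat \<Rightarrow> 'a dual)
     \<Rightarrow> ('a \<Rightarrow> real) set" where
  "interp_class B L m z fv gv =
     {h. smooth_convex B L h \<and> (\<forall>i\<in>{1..m}. h (z i) = fv i \<and> grad h (z i) = gv i)}"

definition lmodel ::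
  "nat \<Rightarrow> (nat \<Rightarrow> 'a::euclidean_space) \<Rightarrow> (nat \<Rightarrow> real) \<Rightarrow> (nat \<Rightarrow> 'a dual) \<Rightarrow> 'a \<Rightarrow> real" where
  "lmodel m z fv gv y = Max ((\<lambda>i. fv i + blinfun_apply (gv i) (y - z i)) ` {1..m})"

definition phi ::
  "('a::euclidean_space \<Rightarrow> 'a dual) \<Rightarrow> real \<Rightarrow> nat \<Rightarrow> (nat \<Rightarrow> 'a) \<Rightarrow> (nat \<Rightarrow> real) \<Rightarrow> (nat \<Rightarrow> 'a dual)
     \<Rightarrow> 'a \<Rightarrow> 'a dual \<Rightarrow> real" where
  "phi B L m z fv gv y g =
     Max ((\<lambda>i. fv i + blinfun_apply (gv i) (y - z i) + 1 / (2 * L) * (dnorm B (g - gv i))\<^sup>2) ` {1..m})"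

(* A minimum, not an infimum: LEAST is unspecified unless the minimum over g is attained;
   attainment is lemma phi_attains_min below. *)
definition pmodel ::
  "('a::euclidean_space \<Rightarrow> 'a dual) \<Rightarrow> real \<Rightarrow> nat \<Rightarrow> (nat \<Rightarrow> 'a) \<Rightarrow> (nat \<Rightarrow> real) \<Rightarrow> (nat \<Rightarrow> 'a dual)
     \<Rightarrow> 'a \<Rightarrow> real" where
  "pmodel B L m z fv gv y = (LEAST v. v \<in> range (phi B L m z fv gv y))"

lemma has_derivative_grad:
  assumes "f differentiable (at x)"
  shows "(f has_derivative blinfun_apply (grad f x)) (at x)"
proof -
  have "(f has_derivative frechet_derivative f (at x)) (at x)"
    using assms frechet_derivative_works by blast
  then show ?thesis
    by (simp add: grad_def bounded_linear_Blinfun_apply has_derivative_bounded_linear)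
qed

lemma sym_posdef_bij:
  fixes B :: "'a::euclidean_space \<Rightarrow> 'a dual"
  assumes "sym_posdef B"
  shows "bij B"
proof -
  have lin: "linear B" and pos: "\<And>x. x \<noteq> 0 \<Longrightarrow> blinfun_apply (B x) x > 0"
    using assms by (auto simp: sym_posdef_def)
  have inj: "inj B"
    unfolding linear_injective_0[OF lin] using pos by (metis less_irrefl zero_blinfun.rep_eq)
  define R where "R g = (\<Sum>b\<in>Basis. blinfun_apply g b *\<^sub>R b)" for g :: "'a dual"
  have R: "R g \<bullet> b = blinfun_apply g b" if "b \<in> Basis" for g b
    using that by (simp add: R_def)
  have Rinj: "g = h" if "R g = R h" for g h
    using that R by (metis blinfun_euclidean_eqI)
  have "linear R"
    by (rule linearI)
       (simp_all add: R_def blinfun.add_left blinfun.scaleR_left scaleR_add_left sum.distrib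
         scaleR_sum_right)
  then have lRB: "linear (R \<circ> B)" using lin linear_compose by blast
  have "inj (R \<circ> B)" using inj Rinj by (auto simp: inj_def)
  then have sRB: "surj (R \<circ> B)" using lRB linear_injective_imp_surjective by blast
  have "surj B"
  proof (rule surjI)
    fix g
    show "B (inv (R \<circ> B) (R g)) = g"
      using surj_f_inv_f[OF sRB, of "R g"] by (intro Rinj) simp
  qed
  with inj show ?thesis by (simp add: bij_def)
qed

lemma phi_attains_min:
  fixes B :: "'a::euclidean_space \<Rightarrow> 'a dual"
  assumes B: "sym_posdef B" and L: "L > 0" and m: "m \<ge> 1"
  shows "\<exists>g. \<forall>h. phi B L m z fv gv y g \<le> phi B L m z fv gv y h"
proof -
  have lin: "linear B" and pos: "\<And>x. x \<noteq> 0 \<Longrightarrow> blinfun_apply (B x) x > 0"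
    using B by (auto simp: sym_posdef_def)
  have bij: "bij B" by (rule sym_posdef_bij[OF B])
  define w where "w i = inv B (gv i)" for i
  define q where "q x = blinfun_apply (B x) x" for x
  define c where "c i = fv i + blinfun_apply (gv i) (y - z i)" for i
  define F where "F x = Max ((\<lambda>i. c i + 1 / (2 * L) * q (x - w i)) ` {1..m})" for x
  have q0: "q x \<ge> 0" for x
    using pos[of x] linear_0[OF lin] by (cases "x = 0") (auto simp: q_def)
  have phiF: "phi B L m z fv gv y (B x) = F x" for x
  proof -
    have "(dnorm B (B x - gv i))\<^sup>2 = q (x - w i)" for i
    proof -
      have "B x - gv i = B (x - w i)"
        by (simp add: w_def linear_diff[OF lin] bij bij_is_surj surj_f_inv_f)
      then show ?thesis
        using q0[of "x - w i"] bij by (simp add: dnorm_def q_def bij_is_inj)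
    qed
    then show ?thesis by (simp add: phi_def F_def c_def)
  qed
  have contB: "continuous_on S B" for S
    using lin linear_conv_bounded_linear linear_continuous_on by blast
  have contq: "continuous_on S q" for S
    unfolding q_def by (intro continuous_intros contB)
  have contF: "continuous_on UNIV F"
  proof -
    have "continuous_on UNIV (\<lambda>x. Max ((\<lambda>i. c i + 1 / (2 * L) * q (x - w i)) ` I))"
      if "finite I" "I \<noteq> {}" for I
      using that
    proof (induction rule: finite_ne_induct)
      case (singleton i)
      have "continuous_on UNIV (\<lambda>x. q (x - w i))"
        by (rule continuous_on_compose2[OF contq[of UNIV]]) (auto intro!: continuous_intros)
      then show ?case using L by (auto intro!: continuous_intros)
    next
      case (insert i I)
      have "continuous_on UNIV (\<lambda>x. q (x - w i))"
        by (rule continuous_on_compose2[OF contq[of UNIV]]) (auto intro!: continuous_intros)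
      with insert show ?case using L by (auto intro!: continuous_intros)
    qed
    then show ?thesis using m by (simp add: F_def)
  qed
  obtain k where k: "k > 0" "\<And>x. k * (norm x)\<^sup>2 \<le> q x"
  proof -
    have "sphere (0::'a) 1 \<noteq> {}" by simp
    then obtain u :: 'a where u: "u \<in> sphere 0 1" "\<And>x. x \<in> sphere 0 1 \<Longrightarrow> q u \<le> q x"
      using continuous_attains_inf[OF compact_sphere _ contq] by blast
    have "q u * (norm x)\<^sup>2 \<le> q x" for x
    proof (cases "x = 0")
      case False
      have "q u \<le> q (x /\<^sub>R norm x)" using False by (intro u) auto
      also have "\<dots> = q x / (norm x)\<^sup>2"
        by (simp add: q_def linear_scale[OF lin] blinfun.scaleR_left blinfun.scaleR_right
            power2_eq_square divide_inverse)
      finally show ?thesis using False by (simp add: field_simps)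
    qed (simp add: q0)
    moreover have "q u > 0" using u(1) pos[of u] by (cases "u = 0") (auto simp: q_def)
    ultimately show thesis using that by blast
  qed
  define d where "d = F (w 1) - c 1"
  define r where "r = sqrt (2 * L * d / k)"
  have F1: "c 1 + 1 / (2 * L) * q (x - w 1) \<le> F x" for x
    unfolding F_def using m by (intro Max_ge) auto
  have d0: "d \<ge> 0" using F1[of "w 1"] L q0[of 0] by (simp add: d_def q_def linear_0[OF lin])
  have r0: "r \<ge> 0" using d0 L k by (simp add: r_def)
  obtain u where u: "u \<in> cball (w 1) r" "\<And>x. x \<in> cball (w 1) r \<Longrightarrow> F u \<le> F x"
    using continuous_attains_inf[OF compact_cball _ continuous_on_subset[OF contF], of "w 1" r] r0
    by force
  have uF: "F u \<le> F x" for x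
  proof (cases "x \<in> cball (w 1) r")
    case False
    then have "r < norm (x - w 1)" by (simp add: dist_norm norm_minus_commute)
    then have "r\<^sup>2 < (norm (x - w 1))\<^sup>2" using r0 by (intro power_strict_mono) auto
    then have "2 * L * d < k * (norm (x - w 1))\<^sup>2"
      using d0 L k(1) by (simp add: r_def field_simps)
    then have "2 * L * d < q (x - w 1)" using k(2)[of "x - w 1"] by linarith
    then have "d < 1 / (2 * L) * q (x - w 1)" using L by (simp add: field_simps)
    then have "F (w 1) < F x" using F1[of x] by (simp add: d_def)
    moreover have "F u \<le> F (w 1)" using u r0 by simp
    ultimately show ?thesis by simp
  qed (use u in auto)
  have "phi B L m z fv gv y (B u) \<le> phi B L m z fv gv y h" for h
    using uF[of "inv B h"] phiF[of u] phiF[of "inv B h"] bij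
    by (simp add: bij_is_surj surj_f_inv_f)
  then show ?thesis by blast
qed

end

(* Every h in S satisfies h y \<ge> h x + <grad h x, y - x> + 1/(2L) * |grad h y - grad h x|^2, so
   grad h y is a feasible choice of g with phi(y, g) \<le> h y.  Convexity of p holds because p is the
   partial minimum of the jointly convex function phi. *)
theory Submission
  imports Defs
begin

section \<open>Restriction of differentiable and convex functions to lines\<close>

lemma has_field_derivative_along_line:
  fixes h :: "'a::euclidean_space \<Rightarrow> real"
  assumes "\<And>x. h differentiable (at x)"
  shows "((\<lambda>t. h (x + t *\<^sub>R v)) has_field_derivative blinfun_apply (grad h (x + t *\<^sub>R v)) v) (at t)"
proof -
  have "((\<lambda>t. x + t *\<^sub>R v) has_derivative (\<lambda>s. s *\<^sub>R v)) (at t)"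
    by (auto intro!: derivative_eq_intros)
  from has_derivative_compose[OF this has_derivative_grad[OF assms]]
  show ?thesis
    by (simp add: has_field_derivative_def blinfun.scaleR_right mult.commute[of _ "blinfun_apply _ _"])
qed

text \<open>Along the line \<open>x + t *\<^sub>R v\<close> with \<open>v = y - x\<close> this is
  the one-dimensional tangent inequality, taken at \<open>t = 0\<close> and evaluated at
  \<open>t = 1\<close>.\<close>

lemma convex_above_tangent:
  fixes h :: "'a::euclidean_space \<Rightarrow> real"
  assumes conv: "convex_on UNIV h" and diff: "\<And>x. h differentiable (at x)"
  shows "h y \<ge> h x + blinfun_apply (grad h x) (y - x)"
proof -
  define v where "v = y - x"
  have "convex_on UNIV (\<lambda>t. h (x + t *\<^sub>R v))"
  proof (rule convex_onI)
    fix t r s :: real assume "0 < t" "t < 1"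
    moreover have "x + ((1 - t) *\<^sub>R r + t *\<^sub>R s) *\<^sub>R v = (1 - t) *\<^sub>R (x + r *\<^sub>R v) + t *\<^sub>R (x + s *\<^sub>R v)"
      by (simp add: algebra_simps)
    ultimately show "h (x + ((1 - t) *\<^sub>R r + t *\<^sub>R s) *\<^sub>R v)
        \<le> (1 - t) * h (x + r *\<^sub>R v) + t * h (x + s *\<^sub>R v)"
      using convex_onD[OF conv, of t] by simp
  qed simp
  from convex_on_imp_above_tangent[OF this, of 0 1 "blinfun_apply (grad h x) v"]
    has_field_derivative_along_line[OF diff, of x v 0]
  show ?thesis by (simp add: v_def)
qed

section \<open>Geometry of the quadratic form of \<open>B\<close> and of the dual norm\<close>

context
  fixes B :: "'a::euclidean_space \<Rightarrow> 'a dual"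
  assumes B: "sym_posdef B"
begin

lemma linear_B: "linear B"
  using B by (simp add: sym_posdef_def)

lemma sym_B: "blinfun_apply (B x) y = blinfun_apply (B y) x"
  using B by (simp add: sym_posdef_def)

lemma B_nonneg: "blinfun_apply (B x) x \<ge> 0"
  using B linear_0[OF linear_B] by (cases "x = 0") (auto simp: sym_posdef_def less_imp_le)

lemma pnorm_nonneg: "pnorm B x \<ge> 0"
  by (simp add: pnorm_def B_nonneg)

lemma pnorm_square: "(pnorm B x)\<^sup>2 = blinfun_apply (B x) x"
  by (simp add: pnorm_def B_nonneg)

lemma pnorm_pos: "x \<noteq> 0 \<Longrightarrow> pnorm B x > 0"
  using B by (simp add: pnorm_def sym_posdef_def)

lemma pnorm_zero: "pnorm B 0 = 0"
  by (simp add: pnorm_def)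

lemma pnorm_scaleR: "pnorm B (c *\<^sub>R x) = \<bar>c\<bar> * pnorm B x"
  by (simp add: pnorm_def linear_scale[OF linear_B] blinfun.scaleR_left blinfun.scaleR_right
      real_sqrt_mult flip: mult.assoc)

lemma B_inv: "B (inv B g) = g"
  by (simp add: sym_posdef_bij[OF B] bij_is_surj surj_f_inv_f)

text \<open>Transports questions about the dual norm to the primal quadratic form, through the
  vector that represents \<open>g\<close>.\<close>

lemma dnorm_eq_pnorm: "dnorm B g = pnorm B (inv B g)"
  by (simp add: dnorm_def pnorm_def B_inv)

lemma dnorm_square: "(dnorm B g)\<^sup>2 = blinfun_apply g (inv B g)"
  by (simp add: dnorm_eq_pnorm pnorm_square B_inv)

lemma linear_inv_B: "linear (inv B)"
proof (rule linearI)
  have inv: "inv B g = x" if "B x = g" for g x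
    using that sym_posdef_bij[OF B] by (auto simp: bij_is_inj)
  show "inv B (g + h) = inv B g + inv B h" for g h
    by (rule inv) (simp add: linear_add[OF linear_B] B_inv)
  show "inv B (c *\<^sub>R g) = c *\<^sub>R inv B g" for c g
    by (rule inv) (simp add: linear_scale[OF linear_B] B_inv)
qed

lemma B_quadratic_combination:
  "blinfun_apply (B (a *\<^sub>R x + b *\<^sub>R y)) (a *\<^sub>R x + b *\<^sub>R y) =
     a\<^sup>2 * blinfun_apply (B x) x + 2 * a * b * blinfun_apply (B x) y + b\<^sup>2 * blinfun_apply (B y) y"
  by (simp add: linear_add[OF linear_B] linear_scale[OF linear_B] blinfun.add_left
      blinfun.add_right blinfun.scaleR_left blinfun.scaleR_right sym_B[of y x]
      power2_eq_square algebra_simps)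

lemma B_Cauchy_Schwarz: "blinfun_apply (B x) y \<le> pnorm B x * pnorm B y"
proof (cases "x = 0 \<or> y = 0")
  case True
  then show ?thesis by (auto simp: pnorm_zero linear_0[OF linear_B])
next
  case False
  \<comment> \<open>Weighting each vector by the norm of the other makes both square terms of the
    expansion equal to \<open>(a * b)\<^sup>2\<close>, so the factor \<open>2 * (a * b)\<close>
    splits off and can be cancelled.\<close>
  define a b where "a = pnorm B x" and "b = pnorm B y"
  have pos: "a * b > 0" using False by (auto simp: a_def b_def pnorm_pos)
  have "0 \<le> blinfun_apply (B (b *\<^sub>R x + (- a) *\<^sub>R y)) (b *\<^sub>R x + (- a) *\<^sub>R y)"
    by (rule B_nonneg)
  also have "\<dots> = 2 * (a * b) * (a * b - blinfun_apply (B x) y)"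
    unfolding B_quadratic_combination
    by (simp add: a_def b_def power2_eq_square algebra_simps flip: pnorm_square)
  finally show ?thesis using pos by (simp add: zero_le_mult_iff a_def b_def)
qed

lemma dual_Cauchy_Schwarz: "blinfun_apply g y \<le> dnorm B g * pnorm B y"
  using B_Cauchy_Schwarz[of "inv B g" y] by (simp add: B_inv dnorm_eq_pnorm)

text \<open>The convexity gap of a quadratic form is exactly \<open>t * (1 - t)\<close> times its
  value at the difference of the two points, hence nonnegative.\<close>

lemma convex_on_dnorm_square: "convex_on UNIV (\<lambda>g. (dnorm B g)\<^sup>2)"
proof (rule convex_onI)
  fix t :: real and g h :: "'a dual"
  assume t: "0 < t" "t < 1"
  define u v where "u = inv B g" and "v = inv B h"
  define Q where "Q x = blinfun_apply (B x) x" for x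
  \<comment> \<open>The difference \<open>u - v\<close> is spelled as a linear combination so that
    \<open>B_quadratic_combination\<close> rewrites it too.\<close>
  have "(1 - t) * Q u + t * Q v - Q ((1 - t) *\<^sub>R u + t *\<^sub>R v) = t * (1 - t) * Q (1 *\<^sub>R u + (- 1) *\<^sub>R v)"
    unfolding Q_def B_quadratic_combination by (simp add: power2_eq_square algebra_simps)
  moreover have "t * (1 - t) * Q (1 *\<^sub>R u + (- 1) *\<^sub>R v) \<ge> 0"
    using t B_nonneg by (simp add: Q_def)
  ultimately show "(dnorm B ((1 - t) *\<^sub>R g + t *\<^sub>R h))\<^sup>2 \<le> (1 - t) * (dnorm B g)\<^sup>2 + t * (dnorm B h)\<^sup>2"
    by (simp add: dnorm_eq_pnorm pnorm_square Q_def u_def v_def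
        linear_add[OF linear_inv_B] linear_scale[OF linear_inv_B])
qed simp

section \<open>Upper and lower quadratic bounds for smooth convex functions\<close>

lemma descent_lemma:
  assumes h: "smooth_convex B L h"
  shows "h (x + v) \<le> h x + blinfun_apply (grad h x) v + L / 2 * (pnorm B v)\<^sup>2"
proof -
  have diff: "\<And>x. h differentiable (at x)"
    and lip: "\<And>x y. dnorm B (grad h x - grad h y) \<le> L * pnorm B (x - y)"
    using h by (auto simp: smooth_convex_def)
  \<comment> \<open>Since \<open>\<psi> 0 = h x\<close>, the claim is
    \<open>\<psi> 1 \<le> \<psi> 0\<close>. Monotonicity of \<open>\<psi>\<close> takes the place of
    integrating the gradient along the segment.\<close>
  define \<psi> where "\<psi> t = h (x + t *\<^sub>R v) - t * blinfun_apply (grad h x) v - L / 2 * t\<^sup>2 * (pnorm B v)\<^sup>2" for t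
  have deriv: "\<exists>D. DERIV \<psi> t :> D \<and> D \<le> 0" if t: "0 \<le> t" for t
  proof (intro exI conjI)
    define d where "d = grad h (x + t *\<^sub>R v) - grad h x"
    show "DERIV \<psi> t :> blinfun_apply d v - L * t * (pnorm B v)\<^sup>2"
      unfolding \<psi>_def d_def
      by (rule derivative_eq_intros has_field_derivative_along_line diff refl)+
         (simp add: blinfun.diff_left)
    \<comment> \<open>Lipschitz continuity over the displacement \<open>t *\<^sub>R v\<close> gives
      a bound linear in \<open>t\<close>, which the derivative of the quadratic term in
      \<open>\<psi>\<close> cancels.\<close>
    have "blinfun_apply d v \<le> dnorm B d * pnorm B v"
      by (rule dual_Cauchy_Schwarz)
    also have "\<dots> \<le> L * (t * pnorm B v) * pnorm B v"
      using lip[of "x + t *\<^sub>R v" x] t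
      by (intro mult_right_mono pnorm_nonneg) (simp add: d_def pnorm_scaleR)
    finally show "blinfun_apply d v - L * t * (pnorm B v)\<^sup>2 \<le> 0"
      by (simp add: power2_eq_square)
  qed
  have "\<psi> 1 \<le> \<psi> 0"
    by (rule DERIV_nonpos_imp_nonincreasing[OF zero_le_one]) (rule deriv)
  then show ?thesis by (simp add: \<psi>_def)
qed

text \<open>At one point \<open>y + v\<close>, \<open>h\<close> lies above its tangent plane at
  \<open>x\<close> and below its quadratic bound at \<open>y\<close>. Comparing the two leaves a
  linear term in \<open>d\<close> and a square term in \<open>v\<close>, which for the chosen
  \<open>v\<close> sum to \<open>- 1 / (2 * L) * (dnorm B d)\<^sup>2\<close>.\<close>

lemma smooth_convex_lower_bound:
  assumes L: "L > 0" and h: "smooth_convex B L h"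
  shows "h x + blinfun_apply (grad h x) (y - x) + 1 / (2 * L) * (dnorm B (grad h y - grad h x))\<^sup>2 \<le> h y"
proof -
  define d where "d = grad h y - grad h x"
  \<comment> \<open>\<open>y + v\<close> minimizes the quadratic upper bound at \<open>y\<close> of \<open>h - \<langle>grad h x, _\<rangle>\<close>.\<close>
  define v where "v = (- (1 / L)) *\<^sub>R inv B d"
  have "h x + blinfun_apply (grad h x) (y + v - x) \<le> h (y + v)"
    using h by (intro convex_above_tangent) (auto simp: smooth_convex_def)
  also have "\<dots> \<le> h y + blinfun_apply (grad h y) v + L / 2 * (pnorm B v)\<^sup>2"
    by (rule descent_lemma[OF h])
  finally have "h x + blinfun_apply (grad h x) (y - x) \<le> h y + blinfun_apply d v + L / 2 * (pnorm B v)\<^sup>2"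
    by (simp add: d_def blinfun.diff_left blinfun.diff_right blinfun.add_right)
  moreover have "blinfun_apply d v = - (1 / L) * (dnorm B d)\<^sup>2"
    by (simp add: v_def dnorm_square blinfun.scaleR_right blinfun.minus_right)
  moreover have "(pnorm B v)\<^sup>2 = (dnorm B d)\<^sup>2 / L\<^sup>2"
    unfolding v_def pnorm_scaleR dnorm_eq_pnorm by (simp add: power_mult_distrib power_divide)
  \<comment> \<open>Both contributions become multiples of the single term
    \<open>1 / (2 * L) * (dnorm B d)\<^sup>2\<close>, so the conclusion is linear
    arithmetic.\<close>
  moreover have "L / 2 * ((dnorm B d)\<^sup>2 / L\<^sup>2) = 1 / (2 * L) * (dnorm B d)\<^sup>2"
    and "1 / L * (dnorm B d)\<^sup>2 = 2 * (1 / (2 * L) * (dnorm B d)\<^sup>2)"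
    using L by (simp_all add: power2_eq_square)
  ultimately show ?thesis
    unfolding d_def by simp
qed

section \<open>Properties of the models \<open>phi\<close>, \<open>pmodel\<close> and
  \<open>lmodel\<close>\<close>

lemma pmodel_attained:
  assumes "L > 0" "m \<ge> 1"
  obtains g where "pmodel B L m z fv gv y = phi B L m z fv gv y g"
    and "\<And>h. pmodel B L m z fv gv y \<le> phi B L m z fv gv y h"
proof -
  obtain g where g: "\<And>h. phi B L m z fv gv y g \<le> phi B L m z fv gv y h"
    using phi_attains_min[OF B assms] by blast
  have "pmodel B L m z fv gv y = phi B L m z fv gv y g"
    \<comment> \<open>The reals are not well-ordered, so \<open>LEAST\<close> can be evaluated only
      by exhibiting an attained minimum.\<close>
    unfolding pmodel_def by (rule Least_equality) (use g in auto)
  with g that show thesis by metis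
qed

lemma phi_ge:
  assumes "i \<in> {1..m}"
  shows "fv i + blinfun_apply (gv i) (y - z i) + 1 / (2 * L) * (dnorm B (g - gv i))\<^sup>2
      \<le> phi B L m z fv gv y g"
  unfolding phi_def using assms by (intro Max_ge) auto

lemma phi_le:
  assumes "m \<ge> 1"
    and "\<And>i. i \<in> {1..m} \<Longrightarrow>
      fv i + blinfun_apply (gv i) (y - z i) + 1 / (2 * L) * (dnorm B (g - gv i))\<^sup>2 \<le> c"
  shows "phi B L m z fv gv y g \<le> c"
  unfolding phi_def using assms by (subst Max_le_iff) auto

text \<open>Each piece of the maximum is affine in the point plus a convex square in the dual
  variable, and a maximum of convex functions is convex.\<close>

lemma phi_jointly_convex:
  assumes L: "L > 0" and m: "m \<ge> 1" and t: "0 \<le> t" "t \<le> 1"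
  shows "phi B L m z fv gv ((1 - t) *\<^sub>R x + t *\<^sub>R y) ((1 - t) *\<^sub>R g + t *\<^sub>R h)
      \<le> (1 - t) * phi B L m z fv gv x g + t * phi B L m z fv gv y h"
proof (rule phi_le[OF m])
  fix i assume i: "i \<in> {1..m}"
  define T where "T u k = fv i + blinfun_apply (gv i) (u - z i) + 1 / (2 * L) * (dnorm B (k - gv i))\<^sup>2" for u k
  \<comment> \<open>The weights sum to one, so the shift by \<open>gv i\<close> distributes over the
    combination and convexity of the unshifted square applies.\<close>
  have "(1 - t) *\<^sub>R g + t *\<^sub>R h - gv i = (1 - t) *\<^sub>R (g - gv i) + t *\<^sub>R (h - gv i)"
    by (simp add: algebra_simps)
  then have "(dnorm B ((1 - t) *\<^sub>R g + t *\<^sub>R h - gv i))\<^sup>2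
      \<le> (1 - t) * (dnorm B (g - gv i))\<^sup>2 + t * (dnorm B (h - gv i))\<^sup>2"
    using convex_onD[OF convex_on_dnorm_square t] by simp
  then have "1 / (2 * L) * (dnorm B ((1 - t) *\<^sub>R g + t *\<^sub>R h - gv i))\<^sup>2
      \<le> 1 / (2 * L) * ((1 - t) * (dnorm B (g - gv i))\<^sup>2 + t * (dnorm B (h - gv i))\<^sup>2)"
    using L by (intro mult_left_mono) auto
  then have "T ((1 - t) *\<^sub>R x + t *\<^sub>R y) ((1 - t) *\<^sub>R g + t *\<^sub>R h) \<le> (1 - t) * T x g + t * T y h"
    unfolding T_def blinfun.diff_right blinfun.add_right blinfun.scaleR_right
    by (simp add: ring_distribs diff_divide_distrib add_divide_distrib)
  also have "\<dots> \<le> (1 - t) * phi B L m z fv gv x g + t * phi B L m z fv gv y h"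
    unfolding T_def using t i by (intro add_mono mult_left_mono phi_ge) auto
  finally show "fv i + blinfun_apply (gv i) ((1 - t) *\<^sub>R x + t *\<^sub>R y - z i)
      + 1 / (2 * L) * (dnorm B ((1 - t) *\<^sub>R g + t *\<^sub>R h - gv i))\<^sup>2
      \<le> (1 - t) * phi B L m z fv gv x g + t * phi B L m z fv gv y h"
    by (simp add: T_def)
qed

text \<open>The convex combination of minimizers \<open>g\<close> at \<open>x\<close> and
  \<open>h\<close> at \<open>y\<close> is a competitor at the combined point. It need not be a
  minimizer there.\<close>

lemma convex_on_pmodel:
  assumes "L > 0" "m \<ge> 1"
  shows "convex_on UNIV (pmodel B L m z fv gv)"
proof (rule convex_onI)
  fix t :: real and x y :: 'a
  assume t: "0 < t" "t < 1"
  obtain g where g: "pmodel B L m z fv gv x = phi B L m z fv gv x g"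
    using pmodel_attained[OF assms] .
  obtain h where h: "pmodel B L m z fv gv y = phi B L m z fv gv y h"
    using pmodel_attained[OF assms] .
  have "pmodel B L m z fv gv ((1 - t) *\<^sub>R x + t *\<^sub>R y)
      \<le> phi B L m z fv gv ((1 - t) *\<^sub>R x + t *\<^sub>R y) ((1 - t) *\<^sub>R g + t *\<^sub>R h)"
    using pmodel_attained[OF assms] by metis
  also have "\<dots> \<le> (1 - t) * pmodel B L m z fv gv x + t * pmodel B L m z fv gv y"
    unfolding g h using t by (intro phi_jointly_convex assms) auto
  finally show "pmodel B L m z fv gv ((1 - t) *\<^sub>R x + t *\<^sub>R y)
      \<le> (1 - t) * pmodel B L m z fv gv x + t * pmodel B L m z fv gv y" .
qed simp

text \<open>For every \<open>g\<close> the squared terms only raise the pieces of the maximum, so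
  the bound holds in particular at a minimizer.\<close>

lemma lmodel_le_pmodel:
  assumes L: "L > 0" and m: "m \<ge> 1"
  shows "lmodel m z fv gv y \<le> pmodel B L m z fv gv y"
proof -
  obtain g where g: "pmodel B L m z fv gv y = phi B L m z fv gv y g"
    using pmodel_attained[OF assms] .
  have "fv i + blinfun_apply (gv i) (y - z i) \<le> phi B L m z fv gv y g" if "i \<in> {1..m}" for i
  proof -
    have "0 \<le> 1 / (2 * L) * (dnorm B (g - gv i))\<^sup>2" using L by simp
    then show ?thesis using phi_ge[OF that, of fv gv y z L g] by linarith
  qed
  then show ?thesis
    unfolding g lmodel_def using m by (subst Max_le_iff) auto
qed

lemma pmodel_le_interpolant:
  assumes L: "L > 0" and m: "m \<ge> 1" and h: "h \<in> interp_class B L m z fv gv"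
  shows "pmodel B L m z fv gv y \<le> h y"
proof -
  have sc: "smooth_convex B L h"
    and data: "\<And>i. i \<in> {1..m} \<Longrightarrow> h (z i) = fv i \<and> grad h (z i) = gv i"
    using h by (auto simp: interp_class_def)
  have "pmodel B L m z fv gv y \<le> phi B L m z fv gv y (grad h y)"
    using pmodel_attained[OF L m] by metis
  also have "\<dots> \<le> h y"
    \<comment> \<open>With base point \<open>z i\<close>, the interpolation conditions turn the
      lower bound into the estimate of the \<open>i\<close>-th piece.\<close>
    using smooth_convex_lower_bound[OF L sc, of "z _" y] data by (intro phi_le[OF m]) metis
  finally show ?thesis .
qed

end

theorem proposition2p4:
  fixes B :: "'a::euclidean_space \<Rightarrow> 'a dual"
    and f :: "'a \<Rightarrow> real" and L :: real
    and m :: nat and z :: "nat \<Rightarrow> 'a"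
  assumes "sym_posdef B"
    and "L > 0"
    and "smooth_convex B L f"
    and "m \<ge> 1"
  shows "convex_on UNIV (pmodel B L m z (\<lambda>i. f (z i)) (\<lambda>i. grad f (z i)))
     \<and> (\<forall>fhat \<in> interp_class B L m z (\<lambda>i. f (z i)) (\<lambda>i. grad f (z i)). \<forall>y.
          lmodel m z (\<lambda>i. f (z i)) (\<lambda>i. grad f (z i)) y
            \<le> pmodel B L m z (\<lambda>i. f (z i)) (\<lambda>i. grad f (z i)) y
        \<and> pmodel B L m z (\<lambda>i. f (z i)) (\<lambda>i. grad f (z i)) y \<le> fhat y)"
  by (intro conjI ballI allI convex_on_pmodel lmodel_le_pmodel pmodel_le_interpolant assms(1,2,4))

end
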